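(* Let $G$ be a weakly connected digraph with $\delta^+(G)\geq 2$ and $\delta^-(G)\geq 1$. For every integer $n\geq 1$, $$Z(L^n(G))\ \geq\ \gamma_P(L^n(G))\ \geq\ \left\lceil \frac{Z(L^n(G))}{\Delta^+(G)}\right\rceil.$$
   Context: A digraph $G$ has a finite non-empty vertex set $V(G)$ and a set $A(G)\subseteq V(G)\times V(G)$ of arcs; loops $(u,u)$ are allowed. $N^+_G(v)=\{u:(v,u)\in A(G)\}$, $N^-_G(v)=\{w:(w,v)\in A(G)\}$, $N^+_G[v]=N^+_G(v)\cup\{v\}$, $N^+_G[S]=\bigcup_{v\in S}N^+_G[v]$, $d^\pm_G(v)=|N^\pm_G(v)|$; $\delta^\pm(G)$ and $\Delta^\pm(G)$ are the minimum and maximum of $d^\pm_G(v)$ over $v\in V(G)$. $G$ is weakly connected if its underlying undirected graph is connected. Line digraph: $L(G)$ has vertex set $\{uv:(u,v)\in A(G)\}$, with an arc from $uv$ to $xy$ exactly when $v=x$. $L^0(G)=G$ and $L^r(G)=L(L^{r-1}(G))$ for $r\geq 1$. Zero forcing in a digraph $H$: for non-empty $S\subseteq V(H)$ put $B^0(S)=S$ and, for $i\ge 0$: if $H$ has no loops, $B^{i+1}(S)=B^i(S)\cup\{v\in V(H)\setminus B^i(S):\exists u\in B^i(S),\ N^+_H(u)\setminus B^i(S)=\{v\}\}$; if $H$ has at least one loop, $B^{i+1}(S)=B^i(S)\cup\{v\in V(H)\setminus B^i(S):\exists u\in V(H),\ N^+_H(u)\setminus B^i(S)=\{v\}\}$.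 $S$ is a zero forcing set if $B^m(S)=V(H)$ for some $m\ge 0$. $Z(H)$ is the minimum cardinality of a zero forcing set of $H$. Power domination in $H$: for non-empty $S\subseteq V(H)$ put $P^0(S)=S$, $P^1(S)=N^+_H[S]$, and for $i\geq 1$ obtain $P^{i+1}(S)$ from $P^i(S)$ by the same rule by which $B^{i+1}(S)$ is obtained from $B^i(S)$ (the loopless rule if $H$ has no loops, the other rule if $H$ has at least one loop). $S$ is a power dominating set if $P^t(S)=V(H)$ for some $t\ge 0$; equivalently, $N^+_H[S]$ is a zero forcing set. $\gamma_P(H)$ is the minimum cardinality of a power dominating set of $H$. *)

theory Defs
  imports Complex_Main "Graph_Theory.Graph_Theory"
begin

(* Digraphs are the parallel-arc-free digraphs "'a pair_pre_digraph" of Graph_Theory; the locale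
   pair_fin_digraph adds finiteness and parcs G \<subseteq> pverts G \<times> pverts G, and allows loops.
   Graph_Theory's "connected" is weak connectedness: it is strong connectedness of the
   symmetrization and includes that the vertex set is non-empty. *)

section \<open>Neighbourhoods and degrees\<close>

definition out_nbrs :: "'a pair_pre_digraph \<Rightarrow> 'a \<Rightarrow> 'a set" where
  "out_nbrs G v = {u. (v, u) \<in> parcs G}"

definition in_nbrs :: "'a pair_pre_digraph \<Rightarrow> 'a \<Rightarrow> 'a set" where
  "in_nbrs G v = {w. (w, v) \<in> parcs G}"

definition closed_out_nbrs :: "'a pair_pre_digraph \<Rightarrow> 'a set \<Rightarrow> 'a set" where
  "closed_out_nbrs G S = (\<Union>v\<in>S. insert v (out_nbrs G v))"

lemma out_degree_eq_card_out_nbrs: "out_degree (with_proj G) v = card (out_nbrs G v)"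
proof -
  have "out_arcs (with_proj G) v = Pair v ` out_nbrs G v"
    by (auto simp: out_arcs_def out_nbrs_def)
  then show ?thesis
    by (simp add: out_degree_def card_image inj_on_def)
qed

lemma in_degree_eq_card_in_nbrs: "in_degree (with_proj G) v = card (in_nbrs G v)"
proof -
  have "in_arcs (with_proj G) v = (\<lambda>w. (w, v)) ` in_nbrs G v"
    by (auto simp: in_arcs_def in_nbrs_def)
  then show ?thesis
    by (simp add: in_degree_def card_image inj_on_def)
qed

definition min_out_degree :: "'a pair_pre_digraph \<Rightarrow> nat" where
  "min_out_degree G = Min (out_degree (with_proj G) ` pverts G)"

definition min_in_degree :: "'a pair_pre_digraph \<Rightarrow> nat" where
  "min_in_degree G = Min (in_degree (with_proj G) ` pverts G)"

definition max_out_degree :: "'a pair_pre_digraph \<Rightarrow> nat" where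
  "max_out_degree G = Max (out_degree (with_proj G) ` pverts G)"

section \<open>Iterated line digraphs\<close>

definition line_digraph :: "'a pair_pre_digraph \<Rightarrow> ('a \<times> 'a) pair_pre_digraph" where
  "line_digraph G =
     \<lparr> pverts = parcs G,
       parcs = {(e, f). e \<in> parcs G \<and> f \<in> parcs G \<and> snd e = fst f} \<rparr>"

definition rename_verts :: "('a \<Rightarrow> 'b) \<Rightarrow> 'a pair_pre_digraph \<Rightarrow> 'b pair_pre_digraph" where
  "rename_verts f G = \<lparr> pverts = f ` pverts G, parcs = map_prod f f ` parcs G \<rparr>"

(* The vertex type of line_digraph differs from that of its argument, so the iteration cannot be
   typed directly for variable n. The nested pairs serving as vertices of the iterates are
   collected in one datatype; the renamings are along its injective constructors, hence
   isomorphisms. *)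
datatype 'a nested = Base 'a | Arc "'a nested" "'a nested"

primrec iter_line_digraph :: "nat \<Rightarrow> 'a pair_pre_digraph \<Rightarrow> 'a nested pair_pre_digraph" where
  "iter_line_digraph 0 G = rename_verts Base G"
| "iter_line_digraph (Suc r) G =
     rename_verts (\<lambda>(u, v). Arc u v) (line_digraph (iter_line_digraph r G))"

section \<open>Zero forcing and power domination\<close>

definition has_loop :: "'a pair_pre_digraph \<Rightarrow> bool" where
  "has_loop H \<longleftrightarrow> (\<exists>u. (u, u) \<in> parcs H)"

(* In a digraph with a loop every vertex may force, otherwise only the vertices already in B. *)
definition force_step :: "'a pair_pre_digraph \<Rightarrow> 'a set \<Rightarrow> 'a set" where
  "force_step H B =
     B \<union> {v \<in> pverts H - B. \<exists>u \<in> (if has_loop H then pverts H else B). out_nbrs H u - B = {v}}"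

primrec zf_iter :: "'a pair_pre_digraph \<Rightarrow> 'a set \<Rightarrow> nat \<Rightarrow> 'a set" where
  "zf_iter H S 0 = S"
| "zf_iter H S (Suc i) = force_step H (zf_iter H S i)"

definition zero_forcing_set :: "'a pair_pre_digraph \<Rightarrow> 'a set \<Rightarrow> bool" where
  "zero_forcing_set H S \<longleftrightarrow> S \<noteq> {} \<and> S \<subseteq> pverts H \<and> (\<exists>m. zf_iter H S m = pverts H)"

definition zero_forcing_number :: "'a pair_pre_digraph \<Rightarrow> nat" where
  "zero_forcing_number H = (LEAST k. \<exists>S. zero_forcing_set H S \<and> card S = k)"

fun pd_iter :: "'a pair_pre_digraph \<Rightarrow> 'a set \<Rightarrow> nat \<Rightarrow> 'a set" where
  "pd_iter H S 0 = S"
| "pd_iter H S (Suc 0) = closed_out_nbrs H S"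
| "pd_iter H S (Suc (Suc i)) = force_step H (pd_iter H S (Suc i))"

definition power_dominating_set :: "'a pair_pre_digraph \<Rightarrow> 'a set \<Rightarrow> bool" where
  "power_dominating_set H S \<longleftrightarrow> S \<noteq> {} \<and> S \<subseteq> pverts H \<and> (\<exists>t. pd_iter H S t = pverts H)"

definition power_domination_number :: "'a pair_pre_digraph \<Rightarrow> nat" where
  "power_domination_number H = (LEAST k. \<exists>S. power_dominating_set H S \<and> card S = k)"

end

theory Submission
  imports Defs
begin

text \<open>
  In a finite non-empty digraph whose out-degrees all lie between \<open>1\<close> and \<open>d\<close>, the zero forcing
  number is at least the power domination number and at most \<open>d\<close> times that number; the iterated
  line digraphs of \<open>G\<close> are such digraphs, with \<open>d\<close> the maximum out-degree of \<open>G\<close>.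

  A zero forcing set is power dominating, since forcing is monotone and the domination step only
  adds vertices to the start set. This gives the upper bound on the power domination number.

  For the lower bound, let \<open>S\<close> be power dominating, so that its closed out-neighbourhood is zero
  forcing. Choose an out-neighbour \<open>x v\<close> of each \<open>v \<in> S\<close>, and leave these chosen vertices out of
  the out-neighbourhoods while keeping \<open>S\<close> itself. Each \<open>v \<in> S\<close> accounts for itself and for all but
  one of its out-neighbours, hence for at most as many vertices as its out-degree; and in a single
  step each \<open>v\<close> forces \<open>x v\<close> if it is still missing. So the smaller set is zero forcing too
  (\<open>zero_forcing_number_le_mult_power_domination_number\<close>).

  Finally, the out-degree of an arc \<open>(u, v)\<close> in the line digraph is the out-degree of \<open>v\<close>, so
  iterating the construction creates no new out-degrees: in every iterate they stay positive and
  bounded by the maximum out-degree of \<open>G\<close>.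
\<close>

section \<open>Zero forcing and power domination\<close>

lemma force_step_mono:
  assumes "B \<subseteq> B'"
  shows "force_step H B \<subseteq> force_step H B'"
proof
  fix v assume v: "v \<in> force_step H B"
  show "v \<in> force_step H B'"
  proof (cases "v \<in> B'")
    case True
    then show ?thesis by (simp add: force_step_def)
  next
    case False
    with v assms obtain u where u: "u \<in> (if has_loop H then pverts H else B)"
        "out_nbrs H u - B = {v}" and "v \<in> pverts H"
      by (auto simp: force_step_def)
    moreover have "out_nbrs H u - B' = {v}" using u(2) False assms by blast
    moreover have "u \<in> (if has_loop H then pverts H else B')"
      using u(1) assms by (auto split: if_splits)
    ultimately show ?thesis using False unfolding force_step_def by blast
  qed
qed

lemma force_step_subset: "B \<subseteq> pverts H \<Longrightarrow> force_step H B \<subseteq> pverts H"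
  by (auto simp: force_step_def)

lemma zf_iter_mono: "B \<subseteq> B' \<Longrightarrow> zf_iter H B m \<subseteq> zf_iter H B' m"
  by (induction m) (simp_all add: force_step_mono)

lemma zf_iter_subset: "B \<subseteq> pverts H \<Longrightarrow> zf_iter H B m \<subseteq> pverts H"
  by (induction m) (simp_all add: force_step_subset)

lemma zf_iter_force_step: "zf_iter H (force_step H B) m = zf_iter H B (Suc m)"
  by (induction m) simp_all

lemma zero_forcing_set_superset:
  assumes "zero_forcing_set H S" "S \<subseteq> T" "T \<subseteq> pverts H"
  shows "zero_forcing_set H T"
proof -
  obtain m where "zf_iter H S m = pverts H"
    using assms(1) by (auto simp: zero_forcing_set_def)
  with assms have "zf_iter H T m = pverts H"
    by (metis subset_antisym zf_iter_mono zf_iter_subset)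
  then show ?thesis using assms by (auto simp: zero_forcing_set_def)
qed

lemma zero_forcing_set_if_force_step:
  assumes "zero_forcing_set H (force_step H T)" "T \<noteq> {}" "T \<subseteq> pverts H"
  shows "zero_forcing_set H T"
  using assms zf_iter_force_step unfolding zero_forcing_set_def by metis

lemma pd_iter_Suc: "pd_iter H S (Suc m) = zf_iter H (closed_out_nbrs H S) m"
  by (induction m) simp_all

context pair_fin_digraph
begin

lemma closed_out_nbrs_subset: "S \<subseteq> pverts G \<Longrightarrow> closed_out_nbrs G S \<subseteq> pverts G"
  using in_arcsD2 by (auto simp: closed_out_nbrs_def out_nbrs_def)

lemma power_dominating_set_iff:
  "power_dominating_set G S \<longleftrightarrow>
     S \<noteq> {} \<and> S \<subseteq> pverts G \<and> zero_forcing_set G (closed_out_nbrs G S)"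
proof
  assume S: "power_dominating_set G S"
  then obtain t where t: "pd_iter G S t = pverts G" and "S \<noteq> {}" "S \<subseteq> pverts G"
    by (auto simp: power_dominating_set_def)
  moreover have "S \<subseteq> closed_out_nbrs G S" by (auto simp: closed_out_nbrs_def)
  moreover have "\<exists>m. zf_iter G (closed_out_nbrs G S) m = pverts G"
  proof (cases t)
    \<comment> \<open>Here \<open>S\<close> is the whole vertex set, and so is its closed out-neighbourhood.\<close>
    case 0
    then have "zf_iter G (closed_out_nbrs G S) 0 = pverts G"
      using t \<open>S \<subseteq> closed_out_nbrs G S\<close> closed_out_nbrs_subset[of S] by auto
    then show ?thesis by blast
  next
    case (Suc m)
    then show ?thesis using t pd_iter_Suc by metis
  qed
  ultimately show "S \<noteq> {} \<and> S \<subseteq> pverts G \<and> zero_forcing_set G (closed_out_nbrs G S)"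
    using closed_out_nbrs_subset unfolding zero_forcing_set_def by blast
next
  assume "S \<noteq> {} \<and> S \<subseteq> pverts G \<and> zero_forcing_set G (closed_out_nbrs G S)"
  then show "power_dominating_set G S"
    unfolding power_dominating_set_def zero_forcing_set_def by (metis pd_iter_Suc)
qed

lemma zero_forcing_set_imp_power_dominating_set:
  assumes "zero_forcing_set G S"
  shows "power_dominating_set G S"
proof -
  have "S \<noteq> {}" "S \<subseteq> pverts G" using assms by (auto simp: zero_forcing_set_def)
  moreover have "S \<subseteq> closed_out_nbrs G S" by (auto simp: closed_out_nbrs_def)
  ultimately show ?thesis
    using zero_forcing_set_superset[OF assms] closed_out_nbrs_subset
    by (simp add: power_dominating_set_iff)
qed

lemma zero_forcing_number_attained:
  assumes "pverts G \<noteq> {}"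
  obtains S where "zero_forcing_set G S" "card S = zero_forcing_number G"
proof -
  have "zf_iter G (pverts G) 0 = pverts G" by simp
  then have "zero_forcing_set G (pverts G)"
    using assms unfolding zero_forcing_set_def by blast
  then have "\<exists>k S. zero_forcing_set G S \<and> card S = k" by blast
  from LeastI_ex[OF this] show ?thesis
    using that unfolding zero_forcing_number_def by blast
qed

lemma power_domination_number_le_zero_forcing_number:
  assumes "pverts G \<noteq> {}"
  shows "power_domination_number G \<le> zero_forcing_number G"
proof -
  obtain S where "zero_forcing_set G S" "card S = zero_forcing_number G"
    using zero_forcing_number_attained assms .
  then show ?thesis
    unfolding power_domination_number_def
    by (intro Least_le) (blast intro: zero_forcing_set_imp_power_dominating_set)
qed

lemma power_domination_number_attained:
  assumes "pverts G \<noteq> {}"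
  obtains S where "power_dominating_set G S" "card S = power_domination_number G"
proof -
  obtain S where "zero_forcing_set G S"
    using zero_forcing_number_attained assms .
  then have "\<exists>k S. power_dominating_set G S \<and> card S = k"
    using zero_forcing_set_imp_power_dominating_set by blast
  from LeastI_ex[OF this] show ?thesis
    using that unfolding power_domination_number_def by blast
qed

text \<open>
  The closed out-neighbourhood of \<open>v\<close> may have one vertex more than the out-degree of \<open>v\<close>. That
  vertex is saved by letting \<open>v\<close> force one of its out-neighbours instead of prescribing it.
\<close>

lemma power_dominating_set_imp_small_zero_forcing_set:
  assumes S: "power_dominating_set G S"
    and deg: "\<And>v. v \<in> S \<Longrightarrow> 1 \<le> card (out_nbrs G v) \<and> card (out_nbrs G v) \<le> d"
  obtains T where "zero_forcing_set G T" "card T \<le> d * card S"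
proof -
  have S_sub: "S \<subseteq> pverts G" and "S \<noteq> {}" and zf: "zero_forcing_set G (closed_out_nbrs G S)"
    using S by (simp_all add: power_dominating_set_iff)
  have "finite S" using finite_subset[OF S_sub] by simp
  have "\<exists>x. x \<in> out_nbrs G v" if "v \<in> S" for v
    using deg[OF that] by (metis all_not_in_conv card.empty not_one_le_zero)
  then obtain x where x: "\<And>v. v \<in> S \<Longrightarrow> x v \<in> out_nbrs G v" by metis
  define C where "C v = insert v (out_nbrs G v - {x v})" for v
  define T where "T = (\<Union>v\<in>S. C v)"
  have "card (C v) \<le> d" if "v \<in> S" for v
  proof -
    have "card (C v) \<le> Suc (card (out_nbrs G v - {x v}))"
      unfolding C_def by (rule card_insert_le_m1) simp_all
    also have "\<dots> = card (out_nbrs G v)"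
      using deg[OF that] x[OF that] by simp
    also have "\<dots> \<le> d" using deg[OF that] by simp
    finally show ?thesis .
  qed
  then have "card T \<le> (\<Sum>v\<in>S. d)"
    unfolding T_def by (intro order_trans[OF card_UN_le[OF \<open>finite S\<close>]] sum_mono)
  then have card_T: "card T \<le> d * card S" by (simp add: mult.commute)
  have "S \<subseteq> T" by (auto simp: T_def C_def)
  have T_sub: "T \<subseteq> pverts G"
    using closed_out_nbrs_subset[OF S_sub] by (auto simp: T_def C_def closed_out_nbrs_def)
  have "closed_out_nbrs G S \<subseteq> force_step G T"
  proof
    fix w assume w: "w \<in> closed_out_nbrs G S"
    show "w \<in> force_step G T"
    proof (cases "w \<in> T")
      case True
      then show ?thesis by (simp add: force_step_def)
    next
      case False
      \<comment> \<open>Then \<open>w\<close> is the chosen out-neighbour of some \<open>v \<in> S\<close>, whose others are all in \<open>T\<close>.\<close>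
      from w obtain v where "v \<in> S" and v: "w \<in> insert v (out_nbrs G v)"
        by (auto simp: closed_out_nbrs_def)
      have "C v \<subseteq> T" using \<open>v \<in> S\<close> by (auto simp: T_def)
      then have "out_nbrs G v - T = {w}" using v False by (auto simp: C_def)
      moreover have "v \<in> (if has_loop G then pverts G else T)"
        using \<open>v \<in> S\<close> S_sub \<open>S \<subseteq> T\<close> by auto
      moreover have "w \<in> pverts G" using w closed_out_nbrs_subset[OF S_sub] by blast
      ultimately show ?thesis using False unfolding force_step_def by blast
    qed
  qed
  then have "zero_forcing_set G (force_step G T)"
    using zf zero_forcing_set_superset force_step_subset T_sub by metis
  then have "zero_forcing_set G T"
    using zero_forcing_set_if_force_step T_sub \<open>S \<subseteq> T\<close> \<open>S \<noteq> {}\<close> by blast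
  then show ?thesis using card_T that by blast
qed

lemma zero_forcing_number_le_mult_power_domination_number:
  assumes "pverts G \<noteq> {}"
    and deg: "\<And>v. v \<in> pverts G \<Longrightarrow> 1 \<le> card (out_nbrs G v) \<and> card (out_nbrs G v) \<le> d"
  shows "zero_forcing_number G \<le> d * power_domination_number G"
proof -
  obtain S where S: "power_dominating_set G S" "card S = power_domination_number G"
    using power_domination_number_attained assms(1) .
  then have "S \<subseteq> pverts G" by (simp add: power_dominating_set_iff)
  with S deg obtain T where "zero_forcing_set G T" "card T \<le> d * card S"
    using power_dominating_set_imp_small_zero_forcing_set[of S d] by blast
  moreover from this have "zero_forcing_number G \<le> card T"
    unfolding zero_forcing_number_def by (blast intro: Least_le)
  ultimately show ?thesis using S by simp
qed

end

section \<open>Out-degrees of iterated line digraphs\<close>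

text \<open>
  Non-emptiness is part of the notion because it has to be carried along with positive out-degrees:
  together they ensure that the line digraph has a vertex again.
\<close>

definition out_degrees_between :: "nat \<Rightarrow> nat \<Rightarrow> 'a pair_pre_digraph \<Rightarrow> bool" where
  "out_degrees_between k d H \<longleftrightarrow> pair_fin_digraph H \<and> pverts H \<noteq> {} \<and>
     (\<forall>v \<in> pverts H. k \<le> card (out_nbrs H v) \<and> card (out_nbrs H v) \<le> d)"

lemma out_degrees_between_rename_verts:
  assumes H: "out_degrees_between k d H" and inj: "inj f"
  shows "out_degrees_between k d (rename_verts f H)"
proof -
  interpret pair_fin_digraph H using H by (simp add: out_degrees_between_def)
  have "pair_fin_digraph (rename_verts f H)"
    by unfold_locales (auto simp: rename_verts_def in_arcsD1 in_arcsD2)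
  moreover have "out_nbrs (rename_verts f H) (f v) = f ` out_nbrs H v" for v
    using inj by (force simp: out_nbrs_def rename_verts_def dest: injD)
  then have "card (out_nbrs (rename_verts f H) (f v)) = card (out_nbrs H v)" for v
    using inj by (simp add: card_image inj_on_subset)
  ultimately show ?thesis
    using H by (auto simp: out_degrees_between_def rename_verts_def)
qed

lemma out_degrees_between_line_digraph:
  assumes H: "out_degrees_between k d H" and "1 \<le> k"
  shows "out_degrees_between k d (line_digraph H)"
proof -
  interpret pair_fin_digraph H using H by (simp add: out_degrees_between_def)
  have "finite (parcs (line_digraph H))"
    by (rule finite_subset[of _ "parcs H \<times> parcs H"]) (auto simp: line_digraph_def)
  then have "pair_fin_digraph (line_digraph H)"
    by unfold_locales (auto simp: line_digraph_def)
  moreover have "pverts (line_digraph H) \<noteq> {}"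
  proof -
    obtain v where "v \<in> pverts H" using H by (auto simp: out_degrees_between_def)
    then have "out_nbrs H v \<noteq> {}"
      using H \<open>1 \<le> k\<close> by (metis card.empty not_one_le_zero order_trans out_degrees_between_def)
    then show ?thesis by (auto simp: out_nbrs_def line_digraph_def)
  qed
  moreover have "k \<le> card (out_nbrs (line_digraph H) e) \<and> card (out_nbrs (line_digraph H) e) \<le> d"
    if e: "e \<in> pverts (line_digraph H)" for e
  proof -
    have "out_nbrs (line_digraph H) e = Pair (snd e) ` out_nbrs H (snd e)"
      using e by (auto simp: out_nbrs_def line_digraph_def)
    then have "card (out_nbrs (line_digraph H) e) = card (out_nbrs H (snd e))"
      by (simp add: card_image inj_on_def)
    moreover have "snd e \<in> pverts H"
      using e in_arcsD2[of "fst e" "snd e"] by (simp add: line_digraph_def)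
    ultimately show ?thesis using H by (simp add: out_degrees_between_def)
  qed
  ultimately show ?thesis by (simp add: out_degrees_between_def)
qed

lemma out_degrees_between_iter_line_digraph:
  assumes "out_degrees_between k d G" "1 \<le> k"
  shows "out_degrees_between k d (iter_line_digraph n G)"
proof (induction n)
  case 0
  then show ?case using assms by (simp add: out_degrees_between_rename_verts inj_def)
next
  case (Suc n)
  have "inj (\<lambda>(u :: 'a nested, v). Arc u v)" by (auto simp: inj_def)
  then show ?case
    using out_degrees_between_line_digraph[OF Suc assms(2)]
    by (simp add: out_degrees_between_rename_verts)
qed

lemma out_degrees_between_min_max:
  assumes "pair_fin_digraph G" "pverts G \<noteq> {}"
  shows "out_degrees_between (min_out_degree G) (max_out_degree G) G"
proof -
  interpret pair_fin_digraph G by fact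
  show ?thesis
    using assms
    by (auto simp: out_degrees_between_def min_out_degree_def max_out_degree_def
        simp flip: out_degree_eq_card_out_nbrs)
qed

theorem corollary4p2:
  fixes G :: "'a pair_pre_digraph" and n :: nat
  assumes "pair_fin_digraph G"
    and "connected (with_proj G)"
    and "min_out_degree G \<ge> 2"
    and "min_in_degree G \<ge> 1"
    and "n \<ge> 1"
  shows "zero_forcing_number (iter_line_digraph n G)
           \<ge> power_domination_number (iter_line_digraph n G)
    \<and> int (power_domination_number (iter_line_digraph n G))
           \<ge> \<lceil>real (zero_forcing_number (iter_line_digraph n G)) / real (max_out_degree G)\<rceil>"
proof -
  define H where "H = iter_line_digraph n G"
  define d where "d = max_out_degree G"
  have "pverts G \<noteq> {}"
    using assms(2) by (auto simp: connected_def strongly_connected_def)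
  then have G: "out_degrees_between (min_out_degree G) d G"
    unfolding d_def by (rule out_degrees_between_min_max[OF assms(1)])
  have H: "out_degrees_between (min_out_degree G) d H"
    unfolding H_def using out_degrees_between_iter_line_digraph[OF G] assms(3) by simp
  interpret H: pair_fin_digraph H using H by (simp add: out_degrees_between_def)
  have "pverts H \<noteq> {}" using H by (simp add: out_degrees_between_def)
  have "1 \<le> card (out_nbrs H v) \<and> card (out_nbrs H v) \<le> d" if "v \<in> pverts H" for v
    using H that assms(3) by (fastforce simp: out_degrees_between_def)
  then have "zero_forcing_number H \<le> d * power_domination_number H"
    using H.zero_forcing_number_le_mult_power_domination_number \<open>pverts H \<noteq> {}\<close> by blast
  then have "real (zero_forcing_number H) \<le> real (power_domination_number H) * real d"
    by (metis mult.commute of_nat_le_iff of_nat_mult)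
  then have "real (zero_forcing_number H) / real d \<le> real (power_domination_number H)"
    by (cases "d = 0") (simp_all add: divide_le_eq)
  then have "\<lceil>real (zero_forcing_number H) / real d\<rceil> \<le> int (power_domination_number H)"
    by (simp add: ceiling_le_iff)
  then show ?thesis
    using H.power_domination_number_le_zero_forcing_number[OF \<open>pverts H \<noteq> {}\<close>]
    unfolding H_def d_def by blast
qed

end
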